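(* Let $\boldsymbol u_1,\boldsymbol u_2\in\mathbb R^d$ with $|\boldsymbol u_1|,|\boldsymbol u_2|<c$. The two-step transport $W=w(\boldsymbol u_2)w(\boldsymbol u_1)$ has an admissible endpoint if and only if $$(c^2-\boldsymbol u_1\cdot\boldsymbol u_2)^2>c^2|\boldsymbol u_1|^2,\qquad\text{i.e.}\qquad \boldsymbol u_1\cdot\boldsymbol u_2<c\,(c-|\boldsymbol u_1|)$$ (on the branch connected to the origin). As equality is approached, $q_{00}\to0$ and $\rho=q_{00}^{-1/2}\to\infty$. In the collinear case $\boldsymbol u_i=u_i\boldsymbol e_1$ with $0<u_i<c$, the subsonicity tensor degenerates simultaneously with $q_{00}$: setting $\mathcal D=(c^2-u_1u_2)^2-c^2u_1^2$, $$q_{00}=\frac{\mathcal D}{c^2(c^2-u_1^2)},\qquad A_{11}=\frac{(c^2-u_1^2)^2(c^2-u_2^2)}{\mathcal D},\qquad A_{22}=\frac{c^4(c^2-u_1^2)}{\mathcal D},$$ so the three quantities share the factor $\mathcal D$, the companion factors being positive. With $M_i=u_i/c$, the collinear boundary $\mathcal D=0$ is $M_1M_2+M_1=1$, and for equal steps $M_1=M_2=M_*$ it is the positive root of $M^2+M=1$, namely $M_*=(\sqrt5-1)/2$. Perpendicular steps ($\boldsymbol u_1\cdot\boldsymbol u_2=0$) never reach the boundary.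
   Context: Fix $c>0$ and $d\in\{2,3\}$; coordinates on $\mathbb R^{1+d}$ are $(t,\boldsymbol x)$, index $0$ refers to $t$, $\boldsymbol e_1,\dots$ is the standard basis of $\mathbb R^d$. For $|\boldsymbol v|<c$ let $\gamma=(1-|\boldsymbol v|^2/c^2)^{-1/2}$, $\hat{\boldsymbol v}=\boldsymbol v/|\boldsymbol v|$ (terms containing $\hat{\boldsymbol v}$ are read as $0$ if $\boldsymbol v=0$); define linear maps (identified with matrices) $g(\boldsymbol v):(t,\boldsymbol x)\mapsto(t,\boldsymbol x-\boldsymbol vt)$, $\ell(\boldsymbol v):(t,\boldsymbol x)\mapsto\bigl(\gamma(t-\boldsymbol v\cdot\boldsymbol x/c^2),\ \boldsymbol x+(\gamma-1)(\hat{\boldsymbol v}\cdot\boldsymbol x)\hat{\boldsymbol v}-\gamma\boldsymbol vt\bigr)$, and $w(\boldsymbol v)=\ell(-\boldsymbol v)g(\boldsymbol v)$. Let $Q_*=\begin{pmatrix}1&0\\0&-c^2I\end{pmatrix}$. Endpoint cometric: $Q_{\mathrm{end}}=W^{-1}Q_*W^{-\mathrm T}$, $q_{00}=(Q_{\mathrm{end}})_{00}$. For $q_{00}\ne0$ write the normalised endpoint as $Q_{\mathrm{end}}/q_{00}=\begin{pmatrix}1&\boldsymbol v^{\mathrm T}\\ \boldsymbol v&\boldsymbol v\boldsymbol v^{\mathrm T}-C\end{pmatrix}$ with $C$ symmetric, and let $A=C-\boldsymbol v\boldsymbol v^{\mathrm T}$ (the subsonicity tensor, with entries $A_{ij}$).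 The endpoint is admissible if $q_{00}>0$ and $A\succ0$ (positive definite). *)

theory Defs
  imports "HOL-Analysis.Analysis"
begin

text \<open>
  Spacetime \<open>\<real>\<^sup>1\<^sup>+\<^sup>d\<close> with \<open>d = CARD('n)\<close> is \<open>real ^ ('n option)\<close>: the index \<open>None\<close> is the
  time index 0, and \<open>Some i\<close> is the spatial index \<open>i\<close>. The speed \<open>c\<close> is an explicit parameter
  throughout.
\<close>

definition event :: "real \<Rightarrow> real ^ 'n \<Rightarrow> real ^ (('n::finite) option)" where
  "event t x = (\<chi> a. case a of None \<Rightarrow> t | Some i \<Rightarrow> x $ i)"

definition time_part :: "real ^ (('n::finite) option) \<Rightarrow> real" where
  "time_part X = X $ None"

definition space_part :: "real ^ (('n::finite) option) \<Rightarrow> real ^ 'n" where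
  "space_part X = (\<chi> i. X $ Some i)"

definition lorentz_factor :: "real \<Rightarrow> real ^ 'n \<Rightarrow> real" where
  "lorentz_factor c v = (1 - (norm v)\<^sup>2 / c\<^sup>2) powr (- 1 / 2)"

definition galilei :: "real ^ 'n \<Rightarrow> real ^ (('n::finite) option) \<Rightarrow> real ^ (('n::finite) option)" where
  "galilei v X = event (time_part X) (space_part X - time_part X *\<^sub>R v)"

text \<open>The unit vector in direction \<open>v\<close> is \<^term>\<open>sgn v\<close>, which is \<open>0\<close> for \<open>v = 0\<close>.\<close>

definition lorentz :: "real \<Rightarrow> real ^ 'n \<Rightarrow> real ^ (('n::finite) option) \<Rightarrow> real ^ (('n::finite) option)" where
  "lorentz c v X =
    (let \<gamma> = lorentz_factor c v; t = time_part X; x = space_part X in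
      event (\<gamma> * (t - (v \<bullet> x) / c\<^sup>2))
            (x + ((\<gamma> - 1) * (sgn v \<bullet> x)) *\<^sub>R sgn v - (\<gamma> * t) *\<^sub>R v))"

lemma linear_galilei: "linear (galilei v)"
  by (rule linearI)
    (auto simp: galilei_def event_def time_part_def space_part_def vec_eq_iff algebra_simps
      split: option.split)

lemma linear_lorentz: "linear (lorentz c v)"
proof -
  have add: "space_part (X + Y) = space_part X + space_part Y" for X Y :: "real ^ (('n::finite) option)"
    by (simp add: space_part_def vec_eq_iff)
  have scale: "space_part (r *\<^sub>R X) = r *\<^sub>R space_part X" for r and X :: "real ^ (('n::finite) option)"
    by (simp add: space_part_def vec_eq_iff)
  show ?thesis
    by (rule linearI)
      (auto simp: lorentz_def Let_def add scale event_def time_part_def vec_eq_iff inner_add_right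
        add_divide_distrib algebra_simps split: option.split)
qed

definition transport :: "real \<Rightarrow> real ^ 'n \<Rightarrow> real ^ (('n::finite) option) ^ (('n::finite) option)" where
  "transport c v = matrix (lorentz c (- v)) ** matrix (galilei v)"

definition two_step :: "real \<Rightarrow> real ^ 'n \<Rightarrow> real ^ 'n \<Rightarrow> real ^ (('n::finite) option) ^ (('n::finite) option)" where
  "two_step c u1 u2 = transport c u2 ** transport c u1"

text \<open>The symmetric block matrix with rows \<open>(\<alpha>, b\<^sup>T)\<close> and \<open>(b, B)\<close>.\<close>

definition block :: "real \<Rightarrow> real ^ 'n \<Rightarrow> real ^ 'n ^ 'n \<Rightarrow> real ^ (('n::finite) option) ^ (('n::finite) option)" where
  "block \<alpha> b B = (\<chi> r s. case r of
      None \<Rightarrow> (case s of None \<Rightarrow> \<alpha> | Some j \<Rightarrow> b $ j)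
    | Some i \<Rightarrow> (case s of None \<Rightarrow> b $ i | Some j \<Rightarrow> B $ i $ j))"

definition Q_star :: "real \<Rightarrow> real ^ (('n::finite) option) ^ (('n::finite) option)" where
  "Q_star c = block 1 0 (mat (- c\<^sup>2))"

definition Q_end :: "real \<Rightarrow> real ^ (('n::finite) option) ^ (('n::finite) option) \<Rightarrow> real ^ (('n::finite) option) ^ (('n::finite) option)" where
  "Q_end c W = matrix_inv W ** Q_star c ** transpose (matrix_inv W)"

definition q00 :: "real \<Rightarrow> real ^ (('n::finite) option) ^ (('n::finite) option) \<Rightarrow> real" where
  "q00 c W = Q_end c W $ None $ None"

definition outer :: "real ^ 'n \<Rightarrow> real ^ 'n ^ 'n" where
  "outer v = (\<chi> i j. v $ i * v $ j)"

text \<open>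
  The next four notions are meant for \<open>q00 c W \<noteq> 0\<close>. Lemma \<open>normalised_endpoint_unique\<close> below shows
  that \<open>endpoint_velocity\<close> and \<open>endpoint_C\<close> are the \<open>v\<close> and \<open>C\<close> of the block form
  with rows \<open>(1, v\<^sup>T)\<close> and \<open>(v, v v\<^sup>T - C)\<close>.
\<close>

definition normalised_endpoint ::
    "real \<Rightarrow> real ^ (('n::finite) option) ^ (('n::finite) option) \<Rightarrow> real ^ (('n::finite) option) ^ (('n::finite) option)" where
  "normalised_endpoint c W = (1 / q00 c W) *\<^sub>R Q_end c W"

definition endpoint_velocity :: "real \<Rightarrow> real ^ (('n::finite) option) ^ (('n::finite) option) \<Rightarrow> real ^ 'n" where
  "endpoint_velocity c W = (\<chi> i. normalised_endpoint c W $ None $ Some i)"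

definition endpoint_C :: "real \<Rightarrow> real ^ (('n::finite) option) ^ (('n::finite) option) \<Rightarrow> real ^ 'n ^ 'n" where
  "endpoint_C c W =
    outer (endpoint_velocity c W) - (\<chi> i j. normalised_endpoint c W $ Some i $ Some j)"

definition subsonicity :: "real \<Rightarrow> real ^ (('n::finite) option) ^ (('n::finite) option) \<Rightarrow> real ^ 'n ^ 'n" where
  "subsonicity c W = endpoint_C c W - outer (endpoint_velocity c W)"

lemma transpose_Q_end:
  fixes W :: "real ^ (('n::finite) option) ^ ('n option)"
  shows "transpose (Q_end c W) = Q_end c W"
proof -
  have "transpose (Q_star c) = (Q_star c :: real ^ (('n::finite) option) ^ (('n::finite) option))"
    by (auto simp: Q_star_def block_def transpose_def mat_def vec_eq_iff split: option.split)
  then show ?thesis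
    by (simp add: Q_end_def matrix_transpose_mul matrix_mul_assoc)
qed

lemma normalised_endpoint_unique:
  assumes "q00 c W \<noteq> 0"
  shows "normalised_endpoint c W = block 1 v (outer v - C) \<longleftrightarrow>
    v = endpoint_velocity c W \<and> C = endpoint_C c W"
proof -
  have diag: "normalised_endpoint c W $ None $ None = 1"
    using assms by (simp add: normalised_endpoint_def q00_def)
  have sym: "normalised_endpoint c W $ Some i $ None = normalised_endpoint c W $ None $ Some i" for i
  proof -
    have "Q_end c W $ Some i $ None = transpose (Q_end c W) $ Some i $ None"
      by (simp only: transpose_Q_end)
    then show ?thesis
      by (simp add: normalised_endpoint_def transpose_def)
  qed
  have all_option: "(\<forall>a. P a) \<longleftrightarrow> P None \<and> (\<forall>i. P (Some i))" for P :: "'a option \<Rightarrow> bool"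
    by (metis option.exhaust)
  show ?thesis
    by (auto simp: vec_eq_iff all_option block_def endpoint_velocity_def endpoint_C_def outer_def
        diag sym algebra_simps)
qed

lemma transpose_endpoint_C: "transpose (endpoint_C c W) = endpoint_C c W"
proof -
  have "Q_end c W $ Some j $ Some i = transpose (Q_end c W) $ Some j $ Some i" for i j
    by (simp only: transpose_Q_end)
  then show ?thesis
    by (simp add: endpoint_C_def normalised_endpoint_def outer_def transpose_def vec_eq_iff
        mult.commute)
qed

definition pos_def :: "real ^ 'n ^ 'n \<Rightarrow> bool" where
  "pos_def A \<longleftrightarrow> transpose A = A \<and> (\<forall>x. x \<noteq> 0 \<longrightarrow> 0 < x \<bullet> (A *v x))"

definition admissible :: "real \<Rightarrow> real ^ (('n::finite) option) ^ (('n::finite) option) \<Rightarrow> bool" where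
  "admissible c W \<longleftrightarrow> 0 < q00 c W \<and> pos_def (subsonicity c W)"

definition rho :: "real \<Rightarrow> real ^ (('n::finite) option) ^ (('n::finite) option) \<Rightarrow> real" where
  "rho c W = q00 c W powr (- 1 / 2)"

end

theory Submission
  imports Defs
begin

text \<open>
  Since \<open>\<ell>(u\<^sub>2)\<close> preserves \<open>Q\<^sub>*\<close>, the quadratic form of the endpoint cometric at a covector \<open>\<xi>\<close> is
  \<open>\<tau>\<^sup>2 - c\<^sup>2|\<kappa>|\<^sup>2\<close> at \<open>(\<tau>, \<kappa>) = g(-u\<^sub>2)\<^sup>T \<ell>(u\<^sub>1)\<^sup>T g(-u\<^sub>1)\<^sup>T \<xi>\<close>. Taking \<open>\<xi> = (1, 0)\<close> gives \<open>q\<^sub>0\<^sub>0\<close>.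
  A spatial covector \<open>\<xi> = (0, k)\<close> is sent to \<open>(u\<^sub>2 \<bullet> K, K)\<close>, where \<open>K\<close> is \<open>k\<close> contracted along
  \<open>u\<^sub>1\<close>, so the form is \<open>(u\<^sub>2 \<bullet> K)\<^sup>2 - c\<^sup>2|K|\<^sup>2 < 0\<close> by the Cauchy-Schwarz inequality. Hence the
  subsonicity tensor is positive definite whenever \<open>q\<^sub>0\<^sub>0 > 0\<close>, and admissibility is decided by
  the sign of \<open>q\<^sub>0\<^sub>0\<close>.
\<close>

section \<open>Splitting events into time and space, and the quadratic form of
  \<open>Q_star\<close>\<close>

lemma time_part_event [simp]: "time_part (event t x) = t"
  by (simp add: time_part_def event_def)

lemma space_part_event [simp]: "space_part (event t x) = x"
  by (simp add: space_part_def event_def vec_eq_iff)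

lemma event_eqI: "time_part X = time_part Y \<Longrightarrow> space_part X = space_part Y \<Longrightarrow> X = Y"
  by (metis (no_types, lifting) time_part_def space_part_def vec_eq_iff vec_lambda_beta
      option.exhaust)

lemma sum_option:
  fixes f :: "'n::finite option \<Rightarrow> real"
  shows "(\<Sum>a\<in>UNIV. f a) = f None + (\<Sum>i\<in>UNIV. f (Some i))"
proof -
  have "(\<Sum>a\<in>UNIV. f a) = f None + sum f (range Some)"
    by (simp add: UNIV_option_conv)
  also have "sum f (range Some) = (\<Sum>i\<in>UNIV. f (Some i))"
    by (simp add: sum.reindex o_def)
  finally show ?thesis .
qed

lemma inner_spacetime: "X \<bullet> Y = time_part X * time_part Y + space_part X \<bullet> space_part Y"
  by (simp add: inner_vec_def sum_option time_part_def space_part_def)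

text \<open>This is the form on covectors: \<open>c\<close> weights the spatial part, whereas the
  interval between events carries it on the time part.\<close>

definition minkowski_form :: "real \<Rightarrow> real ^ ('n::finite option) \<Rightarrow> real" where
  "minkowski_form c X = (time_part X)\<^sup>2 - c\<^sup>2 * (space_part X \<bullet> space_part X)"

lemma Q_star_vec:
  fixes X :: "real ^ ('n::finite option)"
  shows "Q_star c *v X = event (time_part X) (- c\<^sup>2 *\<^sub>R space_part X)"
proof (rule event_eqI)
  show "time_part (Q_star c *v X) = time_part (event (time_part X) (- c\<^sup>2 *\<^sub>R space_part X))"
    by (simp add: time_part_def event_def Q_star_def block_def matrix_vector_mult_def sum_option)
  have "(\<Sum>j\<in>UNIV. (mat (- c\<^sup>2) :: real^'n^'n) $ i $ j * X $ Some j) = - c\<^sup>2 * X $ Some i" for i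
    by (simp add: mat_def if_distrib[of "\<lambda>z. z * _"] cong: if_cong)
  then show "space_part (Q_star c *v X) = space_part (event (time_part X) (- c\<^sup>2 *\<^sub>R space_part X))"
    by (simp add: space_part_def event_def Q_star_def block_def matrix_vector_mult_def sum_option
        vec_eq_iff)
qed

lemma Q_star_form: "X \<bullet> (Q_star c *v X) = minkowski_form c X"
  by (simp add: Q_star_vec inner_spacetime minkowski_form_def power2_eq_square)

section \<open>The Lorentz factor and inversion of boosts\<close>

lemma lorentz_factor_squared:
  assumes "norm v < c"
  shows "(lorentz_factor c v)\<^sup>2 * (1 - (v \<bullet> v) / c\<^sup>2) = 1"
proof -
  have "(norm v)\<^sup>2 < c\<^sup>2" using assms by (simp add: power_strict_mono)
  moreover have "c\<^sup>2 > 0" using assms by (smt (verit) norm_ge_zero zero_less_power)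
  ultimately have p: "0 < 1 - (norm v)\<^sup>2 / c\<^sup>2" by simp
  have "(lorentz_factor c v)\<^sup>2 = (1 - (norm v)\<^sup>2 / c\<^sup>2) powr (- 1)"
    unfolding lorentz_factor_def power2_eq_square by (simp flip: powr_add)
  also have "\<dots> = inverse (1 - (norm v)\<^sup>2 / c\<^sup>2)"
    using p by (simp add: powr_minus)
  finally have "(lorentz_factor c v)\<^sup>2 = inverse (1 - (norm v)\<^sup>2 / c\<^sup>2)" .
  moreover have "1 - (norm v)\<^sup>2 / c\<^sup>2 \<noteq> 0" using p by linarith
  ultimately show ?thesis
    unfolding power2_norm_eq_inner by (metis left_inverse)
qed

lemma lorentz_factor_pos:
  assumes "norm v < c"
  shows "lorentz_factor c v > 0"
  using lorentz_factor_squared[OF assms] unfolding lorentz_factor_def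
  by (metis less_eq_real_def mult_zero_left powr_ge_zero power_zero_numeral zero_neq_one)

text \<open>The term of the boost with the unit vector equals this coefficient times
  \<open>(v \<bullet> x) *\<^sub>R v\<close>, so that boosts become rational in \<open>v\<close> and
  the Lorentz factor. For \<open>v = 0\<close> division by zero gives 0.\<close>

definition boost_coeff :: "real \<Rightarrow> real ^ 'n \<Rightarrow> real" where
  "boost_coeff c v = (lorentz_factor c v - 1) / (v \<bullet> v)"

lemma boost_coeff_eq: "boost_coeff c v * (v \<bullet> v) = lorentz_factor c v - 1"
  by (simp add: boost_coeff_def lorentz_factor_def)

lemma boost_projection:
  "((lorentz_factor c v - 1) * (sgn v \<bullet> x)) *\<^sub>R sgn v = (boost_coeff c v * (v \<bullet> x)) *\<^sub>R v"
proof -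
  have "inverse (norm v) * inverse (norm v) = 1 / (v \<bullet> v)"
    by (simp add: dot_square_norm power2_eq_square field_simps)
  then show ?thesis
    by (simp add: sgn_div_norm boost_coeff_def divide_inverse mult.assoc mult.left_commute)
qed

lemma lorentz_uminus [simp]: "lorentz_factor c (- v) = lorentz_factor c v"
  "boost_coeff c (- v) = boost_coeff c v"
  by (simp_all add: lorentz_factor_def boost_coeff_def)

lemma lorentz_eq:
  "lorentz c v X = event (lorentz_factor c v * (time_part X - (v \<bullet> space_part X) / c\<^sup>2))
     (space_part X + (boost_coeff c v * (v \<bullet> space_part X)
        - lorentz_factor c v * time_part X) *\<^sub>R v)"
  unfolding lorentz_def Let_def boost_projection by (simp add: algebra_simps)

lemma galilei_uminus_galilei: "galilei (- v) (galilei v X) = X"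
  by (rule event_eqI) (simp_all add: galilei_def)

text \<open>Both boosts change the spatial part only along \<open>v\<close>. The claim therefore
  reduces to two scalar identities, one for time and one for the coefficient of
  \<open>v\<close>.\<close>

lemma lorentz_lorentz_uminus:
  assumes "norm v < c"
  shows "lorentz c v (lorentz c (- v) X) = X"
proof -
  define g a s where "g = lorentz_factor c v" and "a = boost_coeff c v" and "s = v \<bullet> v"
  define t p where "t = time_part X" and "p = v \<bullet> space_part X"
  have c: "c > 0" using assms norm_ge_zero le_less_trans by blast
  have g: "g\<^sup>2 * (1 - s / c\<^sup>2) = 1" and a: "a * s = g - 1"
    using lorentz_factor_squared[OF assms] boost_coeff_eq[of c v] by (simp_all add: g_def s_def a_def)
  \<comment> \<open>Together with \<open>a * s = g - 1\<close>, this removes \<open>s\<close> from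
    the terms below once they are grouped as \<open>a * s\<close> and
    \<open>g\<^sup>2 * s\<close>.\<close>
  have g': "g\<^sup>2 * s = c\<^sup>2 * (g\<^sup>2 - 1)" using g c by (simp add: field_simps)
  have time: "g * (g * (t + p / c\<^sup>2) - (p + (a * p + g * t) * s) / c\<^sup>2) = t"
  proof -
    have "g * (g * (t + p / c\<^sup>2) - (p + (a * p + g * t) * s) / c\<^sup>2) * c\<^sup>2
       = g\<^sup>2 * t * c\<^sup>2 + g\<^sup>2 * p - g * p - g * p * (a * s) - t * (g\<^sup>2 * s)"
      using c by (simp add: field_simps power2_eq_square)
    also have "\<dots> = t * c\<^sup>2" unfolding a g' by (simp add: algebra_simps power2_eq_square)
    finally show ?thesis using c by simp
  qed
  have space: "a * p + g * t + (a * (p + (a * p + g * t) * s) - g * (g * (t + p / c\<^sup>2))) = 0"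
  \<comment> \<open>The coefficient \<open>a\<close> is controlled only through
    \<open>a * s\<close>, so the identity is first multiplied by \<open>s\<close> and then
    cancelled. This requires \<open>s > 0\<close>; for \<open>v = 0\<close> one has
    \<open>g = 1\<close> and \<open>p = 0\<close>.\<close>
  proof (cases "v = 0")
    case True
    then show ?thesis using g a by (simp add: p_def s_def power2_eq_square algebra_simps)
  next
    case False
    then have s: "s > 0" by (simp add: s_def)
    have "(a * p + g * t + (a * (p + (a * p + g * t) * s) - g * (g * (t + p / c\<^sup>2)))) * s
      = p * (a * s) + g * t * s + p * (a * s) + (a * s) * (a * s) * p + (a * s) * g * t * s
        - t * (g\<^sup>2 * s) - p * (g\<^sup>2 * s) / c\<^sup>2"
      by (simp add: algebra_simps power2_eq_square)
    also have "\<dots> = 0"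
    proof -
      have "p * (g\<^sup>2 * s) / c\<^sup>2 = p * (g\<^sup>2 - 1)" unfolding g' using c by simp
      then show ?thesis
        unfolding a by (simp add: algebra_simps power2_eq_square)
    qed
    finally show ?thesis using s by simp
  qed
  show ?thesis
  proof (rule event_eqI)
    show "time_part (lorentz c v (lorentz c (- v) X)) = time_part X"
      using time
      by (simp add: lorentz_eq inner_diff_right inner_add_right flip: g_def a_def s_def t_def p_def)
        (simp add: algebra_simps)
    have "space_part (lorentz c v (lorentz c (- v) X)) = space_part X
      + (a * p + g * t + (a * (p + (a * p + g * t) * s) - g * (g * (t + p / c\<^sup>2)))) *\<^sub>R v"
      by (simp add: lorentz_eq inner_diff_right inner_add_right flip: g_def a_def s_def t_def p_def)
        (simp add: vec_eq_iff algebra_simps)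
    then show "space_part (lorentz c v (lorentz c (- v) X)) = space_part X"
      unfolding space by simp
  qed
qed

section \<open>Transposed Galilei and Lorentz maps acting on covectors\<close>

definition cogalilei :: "real ^ 'n \<Rightarrow> real ^ ('n::finite option) \<Rightarrow> real ^ ('n option)" where
  "cogalilei v X = event (time_part X - v \<bullet> space_part X) (space_part X)"

text \<open>Transposition moves the factor \<open>1 / c\<^sup>2\<close> of the boost from the time
  component to the space component.\<close>

definition colorentz :: "real \<Rightarrow> real ^ 'n \<Rightarrow> real ^ ('n::finite option) \<Rightarrow> real ^ ('n option)" where
  "colorentz c v X = event (lorentz_factor c v * (time_part X - v \<bullet> space_part X))
     (space_part X + (boost_coeff c v * (v \<bullet> space_part X)
        - lorentz_factor c v * time_part X / c\<^sup>2) *\<^sub>R v)"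

text \<open>Uniqueness of the adjoint identifies the transpose from an inner product identity,
  without computing matrix entries.\<close>

lemma transpose_matrix_vec:
  fixes f :: "real ^ 'm::finite \<Rightarrow> real ^ 'k::finite"
  assumes "linear f" and "\<And>x y. f x \<bullet> y = x \<bullet> g y"
  shows "transpose (matrix f) *v y = g y"
proof -
  have "adjoint f = g" using assms(2) by (intro adjoint_unique) auto
  then show ?thesis
    using matrix_adjoint[OF assms(1)] matrix_vector_mul(2)[OF adjoint_linear[OF assms(1)]] by metis
qed

lemma transpose_galilei: "transpose (matrix (galilei v)) *v X = cogalilei v X"
  by (rule transpose_matrix_vec[OF linear_galilei])
    (simp add: inner_spacetime galilei_def cogalilei_def inner_diff_left inner_diff_right algebra_simps)

lemma transpose_lorentz: "transpose (matrix (lorentz c v)) *v X = colorentz c v X"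
  by (rule transpose_matrix_vec[OF linear_lorentz])
    (simp add: inner_spacetime lorentz_eq colorentz_def inner_diff_left inner_diff_right inner_add_left
      inner_add_right algebra_simps inner_commute)

text \<open>Invariance of \<open>Q_star\<close> under boosts. It makes the boost by
  \<open>u2\<close> disappear from the endpoint form.\<close>

lemma minkowski_form_colorentz:
  assumes "norm v < c"
  shows "minkowski_form c (colorentz c v X) = minkowski_form c X"
proof -
  define g a s where "g = lorentz_factor c v" and "a = boost_coeff c v" and "s = v \<bullet> v"
  define t x p where "t = time_part X" and "x = space_part X" and "p = v \<bullet> space_part X"
  have c: "c > 0" using assms norm_ge_zero le_less_trans by blast
  have g: "g\<^sup>2 * (1 - s / c\<^sup>2) = 1" and a: "a * s = g - 1"
    using lorentz_factor_squared[OF assms] boost_coeff_eq[of c v] by (simp_all add: g_def s_def a_def)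
  have g': "g\<^sup>2 * s = c\<^sup>2 * (g\<^sup>2 - 1)" using g c by (simp add: field_simps)
  have xv: "x \<bullet> v = p" by (simp add: x_def p_def inner_commute)
  \<comment> \<open>The coefficient of \<open>p\<^sup>2\<close> needs a relation for
    \<open>a\<close> alone. It is again obtained by multiplying with \<open>s\<close>, while for
    \<open>v = 0\<close> the factor \<open>p\<close> vanishes.\<close>
  have a2: "c\<^sup>2 * (2 * a + a * (a * s)) * p\<^sup>2 = g\<^sup>2 * p\<^sup>2"
  proof (cases "v = 0")
    case True
    then show ?thesis by (simp add: p_def)
  next
    case False
    then have s: "s > 0" by (simp add: s_def)
    have "c\<^sup>2 * (2 * a + a * (a * s)) * s = c\<^sup>2 * (2 * (a * s) + (a * s) * (a * s))"
      by (simp add: algebra_simps)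
    also have "\<dots> = g\<^sup>2 * s" unfolding a g' by (simp add: algebra_simps power2_eq_square)
    finally show ?thesis using s by simp
  qed
  \<comment> \<open>\<open>b\<close> is the coefficient of \<open>v\<close> in the spatial part of
    the transformed covector.\<close>
  define b where "b = a * p - g * t / c\<^sup>2"
  have "(x + b *\<^sub>R v) \<bullet> (x + b *\<^sub>R v) = x \<bullet> x + 2 * b * p + b\<^sup>2 * s"
    by (simp add: inner_add_left inner_add_right xv power2_eq_square flip: s_def)
      (simp add: p_def x_def algebra_simps)
  moreover have "c\<^sup>2 * (2 * b * p + b\<^sup>2 * s) = (g * (t - p))\<^sup>2 - t\<^sup>2"
  proof -
    have "c\<^sup>2 * (2 * b * p + b\<^sup>2 * s) = c\<^sup>2 * (2 * a + a * (a * s)) * p\<^sup>2 - 2 * g * t * p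
        - 2 * (a * s) * p * g * t + (g\<^sup>2 * s) * t\<^sup>2 / c\<^sup>2"
      using c by (simp add: b_def field_simps power2_eq_square)
    also have "\<dots> = (g * (t - p))\<^sup>2 - t\<^sup>2"
      unfolding a2 g' unfolding a using c by (simp add: field_simps power2_eq_square)
    finally show ?thesis .
  qed
  moreover have "minkowski_form c (colorentz c v X)
    = (g * (t - p))\<^sup>2 - c\<^sup>2 * ((x + b *\<^sub>R v) \<bullet> (x + b *\<^sub>R v))"
    by (simp add: minkowski_form_def colorentz_def b_def g_def a_def t_def x_def p_def)
  ultimately show ?thesis
    by (simp add: minkowski_form_def distrib_left flip: t_def x_def)
qed

section \<open>The inverse of the two-step transport\<close>

lemma matrix_inv_eqI:
  fixes A :: "real ^ 'n ^ 'n"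
  assumes "A ** B = mat 1"
  shows "matrix_inv A = B"
proof -
  have "B ** A = mat 1" using assms matrix_left_right_inverse by blast
  then have "invertible A" using assms unfolding invertible_def by blast
  \<comment> \<open>\<open>matrix_inv\<close> is a choice among two-sided inverses; whichever is
    chosen cancels \<open>A\<close> and hence equals \<open>B\<close>.\<close>
  then have "matrix_inv A ** A = mat 1"
    unfolding matrix_inv_def invertible_def by (metis (mono_tags, lifting) someI_ex)
  then have "matrix_inv A ** (A ** B) = B" by (simp add: matrix_mul_assoc)
  then show ?thesis using assms by simp
qed

lemma galilei_mult_uminus: "matrix (galilei v) ** matrix (galilei (- v)) = mat 1"
proof -
  have "galilei v \<circ> galilei (- v) = id"
    using galilei_uminus_galilei[of "- v"] by (auto simp: fun_eq_iff)
  then show ?thesis by (simp add: matrix_id_mat_1 flip: matrix_compose[OF linear_galilei linear_galilei])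
qed

lemma lorentz_uminus_mult:
  assumes "norm v < c"
  shows "matrix (lorentz c (- v)) ** matrix (lorentz c v) = mat 1"
proof -
  have "lorentz c (- v) \<circ> lorentz c v = id"
    using lorentz_lorentz_uminus[of "- v" c] assms by (auto simp: fun_eq_iff)
  then show ?thesis by (simp add: matrix_id_mat_1 flip: matrix_compose[OF linear_lorentz linear_lorentz])
qed

lemma matrix_inv_two_step:
  assumes "norm u1 < c" "norm u2 < c"
  shows "matrix_inv (two_step c u1 u2)
    = (matrix (galilei (- u1)) ** matrix (lorentz c u1))
      ** (matrix (galilei (- u2)) ** matrix (lorentz c u2))"
proof -
  have T: "transport c v ** (matrix (galilei (- v)) ** matrix (lorentz c v)) = mat 1"
    if "norm v < c" for v
  proof -
    have "transport c v ** (matrix (galilei (- v)) ** matrix (lorentz c v))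
      = matrix (lorentz c (- v)) ** (matrix (galilei v) ** matrix (galilei (- v))) ** matrix (lorentz c v)"
      by (simp add: transport_def matrix_mul_assoc)
    then show ?thesis by (simp add: galilei_mult_uminus lorentz_uminus_mult[OF that])
  qed
  show ?thesis
  proof (rule matrix_inv_eqI)
    let ?A1 = "matrix (galilei (- u1)) ** matrix (lorentz c u1)"
    let ?A2 = "matrix (galilei (- u2)) ** matrix (lorentz c u2)"
    have "two_step c u1 u2 ** (?A1 ** ?A2) = transport c u2 ** (transport c u1 ** ?A1) ** ?A2"
      by (simp add: two_step_def matrix_mul_assoc)
    then show "two_step c u1 u2 ** (?A1 ** ?A2) = mat 1"
      by (simp add: T assms)
  qed
qed

section \<open>The endpoint quadratic form and its time-time entry\<close>

lemma inner_mult_form: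
  fixes V Q :: "real ^ 'n ^ 'n"
  shows "X \<bullet> ((V ** Q ** transpose V) *v X) = (transpose V *v X) \<bullet> (Q *v (transpose V *v X))"
  by (simp add: dot_lmul_matrix flip: matrix_vector_mul_assoc)

text \<open>Transposing the inverse reverses the factors, so the maps of \<open>u1\<close> act on
  the covector first and the boost by \<open>u2\<close> acts last. By invariance that last boost
  drops out, and only the Galilei part of the second step remains.\<close>

lemma Q_end_form:
  assumes "norm u1 < c" "norm u2 < c"
  shows "X \<bullet> (Q_end c (two_step c u1 u2) *v X)
    = minkowski_form c (cogalilei (- u2) (colorentz c u1 (cogalilei (- u1) X)))"
  unfolding Q_end_def inner_mult_form Q_star_form matrix_inv_two_step[OF assms]
  by (simp add: matrix_transpose_mul transpose_galilei transpose_lorentz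
      minkowski_form_colorentz[OF assms(2)] del: transpose_matrix_vector flip: matrix_vector_mul_assoc)

lemma q00_two_step:
  assumes "norm u1 < c" "norm u2 < c"
  shows "q00 c (two_step c u1 u2)
    = ((c\<^sup>2 - u1 \<bullet> u2)\<^sup>2 - c\<^sup>2 * (norm u1)\<^sup>2) / (c\<^sup>2 * (c\<^sup>2 - (norm u1)\<^sup>2))"
proof -
  have c: "c > 0" using assms norm_ge_zero le_less_trans by blast
  have lt: "(norm u1)\<^sup>2 < c\<^sup>2" using assms by (simp add: power_strict_mono)
  define g s p where "g = lorentz_factor c u1" and "s = u1 \<bullet> u1" and "p = u1 \<bullet> u2"
  have s: "(norm u1)\<^sup>2 = s" by (simp add: s_def power2_norm_eq_inner)
  have g: "g\<^sup>2 = c\<^sup>2 / (c\<^sup>2 - s)"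
    using lorentz_factor_squared[OF assms(1)] c lt unfolding s
    by (simp add: g_def s_def field_simps)
  have "q00 c (two_step c u1 u2)
     = event 1 0 \<bullet> (Q_end c (two_step c u1 u2) *v event 1 0)"
    by (simp add: inner_spacetime)
      (simp add: q00_def time_part_def matrix_vector_mult_def sum_option event_def)
  \<comment> \<open>The covector \<open>event 1 0\<close> is unchanged by the first Galilei step,
    becomes \<open>event g (- (g / c\<^sup>2) *\<^sub>R u1)\<close> under the boost, and then gains
    \<open>- g / c\<^sup>2 * p\<close> in time.\<close>
  also have "\<dots> = (g - g / c\<^sup>2 * p)\<^sup>2 - c\<^sup>2 * ((g / c\<^sup>2)\<^sup>2 * s)"
    unfolding Q_end_form[OF assms]
    by (simp add: minkowski_form_def cogalilei_def colorentz_def power2_eq_square inner_commute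
      flip: g_def p_def s_def)
  also have "\<dots> = g\<^sup>2 * ((c\<^sup>2 - p)\<^sup>2 - c\<^sup>2 * s) / c ^ 4"
    using c by (simp add: field_simps power2_eq_square power4_eq_xxxx)
  also have "\<dots> = ((c\<^sup>2 - p)\<^sup>2 - c\<^sup>2 * s) / (c\<^sup>2 * (c\<^sup>2 - s))"
    using c lt unfolding g s by (simp add: field_simps power2_eq_square power4_eq_xxxx)
  finally show ?thesis unfolding s p_def .
qed

section \<open>Positivity of the subsonicity tensor and the criterion for admissibility\<close>

text \<open>The contraction of \<open>k\<close> by \<open>1 / \<gamma>\<close> along \<open>u\<close>. The covector \<open>(0, k)\<close> has time
  component \<open>u \<bullet> k\<close> after the Galilei step, and the boost by \<open>u\<close> returns it to \<open>0\<close>.\<close>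

definition contraction :: "real \<Rightarrow> real ^ 'n \<Rightarrow> real ^ 'n \<Rightarrow> real ^ 'n" where
  "contraction c u k = k + ((boost_coeff c u - lorentz_factor c u / c\<^sup>2) * (u \<bullet> k)) *\<^sub>R u"

text \<open>By \<open>boost_coeff_eq\<close> the left side is the Lorentz factor times
  \<open>1 - (u \<bullet> u) / c\<^sup>2\<close>, and that second factor is the inverse square of
  the Lorentz factor.\<close>

lemma contraction_factor:
  assumes "norm u < c"
  shows "1 + (boost_coeff c u - lorentz_factor c u / c\<^sup>2) * (u \<bullet> u) = 1 / lorentz_factor c u"
proof -
  have "lorentz_factor c u > 0" by (rule lorentz_factor_pos[OF assms])
  then have "1 / lorentz_factor c u = lorentz_factor c u * (1 - (u \<bullet> u) / c\<^sup>2)"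
    using lorentz_factor_squared[OF assms] by (simp add: field_simps power2_eq_square)
  then show ?thesis using boost_coeff_eq[of c u] by (simp add: left_diff_distrib right_diff_distrib)
qed

lemma inner_contraction:
  assumes "norm u < c"
  shows "u \<bullet> contraction c u k = (u \<bullet> k) / lorentz_factor c u"
proof -
  have "u \<bullet> contraction c u k
    = (1 + (boost_coeff c u - lorentz_factor c u / c\<^sup>2) * (u \<bullet> u)) * (u \<bullet> k)"
    by (simp add: contraction_def inner_add_right algebra_simps)
  then show ?thesis unfolding contraction_factor[OF assms] by simp
qed

text \<open>A vanishing contraction forces \<open>u \<bullet> k = 0\<close>, and vectors orthogonal
  to \<open>u\<close> are fixed. This injectivity makes the subsonicity form strictly
  positive.\<close>

lemma contraction_eq_0_iff:
  assumes "norm u < c"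
  shows "contraction c u k = 0 \<longleftrightarrow> k = 0"
proof
  assume K: "contraction c u k = 0"
  then have "u \<bullet> k = 0"
    using inner_contraction[OF assms, of k] lorentz_factor_pos[OF assms] by simp
  then show "k = 0" using K by (simp add: contraction_def)
qed (simp add: contraction_def)

text \<open>The two outer products of the endpoint velocity cancel: the tensor is minus the spatial
  block of the normalised endpoint.\<close>

lemma subsonicity_form:
  "x \<bullet> (subsonicity c W *v x) = - (event 0 x \<bullet> (Q_end c W *v event 0 x)) / q00 c W"
proof -
  have "event 0 x \<bullet> (Q_end c W *v event 0 x)
      = (\<Sum>i\<in>UNIV. \<Sum>j\<in>UNIV. x $ i * (Q_end c W $ Some i $ Some j * x $ j))"
    by (simp add: inner_vec_def sum_option matrix_vector_mult_def event_def sum_distrib_left)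
  moreover have "x \<bullet> (subsonicity c W *v x)
      = (\<Sum>i\<in>UNIV. \<Sum>j\<in>UNIV. - (x $ i * (Q_end c W $ Some i $ Some j * x $ j)) / q00 c W)"
    by (simp add: inner_vec_def matrix_vector_mult_def subsonicity_def endpoint_C_def
        normalised_endpoint_def sum_distrib_left)
  ultimately show ?thesis
    by (simp add: sum_divide_distrib sum_negf)
qed

lemma subsonicity_two_step:
  assumes "norm u1 < c" "norm u2 < c"
  shows "x \<bullet> (subsonicity c (two_step c u1 u2) *v x)
    = (c\<^sup>2 * (norm (contraction c u1 x))\<^sup>2 - (u2 \<bullet> contraction c u1 x)\<^sup>2) / q00 c (two_step c u1 u2)"
proof -
  have "cogalilei (- u2) (colorentz c u1 (cogalilei (- u1) (event 0 x)))
     = event (u2 \<bullet> contraction c u1 x) (contraction c u1 x)"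
    by (simp add: cogalilei_def colorentz_def contraction_def left_diff_distrib)
  then show ?thesis
    unfolding subsonicity_form Q_end_form[OF assms]
    by (simp add: minkowski_form_def power2_norm_eq_inner)
qed

lemma transpose_subsonicity: "transpose (subsonicity c W) = subsonicity c W"
proof -
  have "endpoint_C c W $ j $ i = transpose (endpoint_C c W) $ j $ i" for i j
    by (simp only: transpose_endpoint_C)
  then show ?thesis
    by (simp add: subsonicity_def outer_def transpose_def vec_eq_iff mult.commute)
qed

lemma admissible_two_step:
  assumes "norm u1 < c" "norm u2 < c"
  shows "admissible c (two_step c u1 u2) \<longleftrightarrow> (c\<^sup>2 - u1 \<bullet> u2)\<^sup>2 > c\<^sup>2 * (norm u1)\<^sup>2"
proof -
  have c: "c > 0" using assms norm_ge_zero le_less_trans by blast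
  have "(norm u1)\<^sup>2 < c\<^sup>2" using assms by (simp add: power_strict_mono)
  then have q: "0 < q00 c (two_step c u1 u2) \<longleftrightarrow> (c\<^sup>2 - u1 \<bullet> u2)\<^sup>2 > c\<^sup>2 * (norm u1)\<^sup>2"
    unfolding q00_two_step[OF assms] using c by (simp add: pos_less_divide_eq)
  have "0 < x \<bullet> (subsonicity c (two_step c u1 u2) *v x)"
    if "x \<noteq> 0" "0 < q00 c (two_step c u1 u2)" for x
  proof -
    have "norm (contraction c u1 x) > 0"
      using that contraction_eq_0_iff[OF assms(1)] by simp
    \<comment> \<open>Cauchy-Schwarz becomes strict because \<open>norm u2 < c\<close> and the
      contracted vector is nonzero.\<close>
    then have "\<bar>u2 \<bullet> contraction c u1 x\<bar> < c * norm (contraction c u1 x)"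
      using Cauchy_Schwarz_ineq2[of u2 "contraction c u1 x"] assms(2)
      by (smt (verit) mult_strict_right_mono)
    then have "(u2 \<bullet> contraction c u1 x)\<^sup>2 < (c * norm (contraction c u1 x))\<^sup>2"
      by (metis abs_ge_zero power2_abs power_strict_mono zero_less_numeral)
    then show ?thesis
      unfolding subsonicity_two_step[OF assms] using that by (simp add: power_mult_distrib)
  qed
  then show ?thesis
    unfolding admissible_def pos_def_def q[symmetric] using transpose_subsonicity by blast
qed

section \<open>The linear form of the condition and the branch through the origin\<close>

lemma admissibility_condition_iff:
  fixes u1 u2 :: "real ^ 'n"
  assumes "norm u1 < c" "norm u2 < c"
  shows "(c\<^sup>2 - u1 \<bullet> u2)\<^sup>2 > c\<^sup>2 * (norm u1)\<^sup>2 \<longleftrightarrow> u1 \<bullet> u2 < c * (c - norm u1)"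
proof -
  have c: "c > 0" using assms norm_ge_zero le_less_trans by blast
  \<comment> \<open>Cauchy-Schwarz gives \<open>c\<^sup>2 - u1 \<bullet> u2\<close> a sign, which
    excludes the negative square root and lets the squares be removed.\<close>
  have "u1 \<bullet> u2 \<le> norm u1 * norm u2" by (rule norm_cauchy_schwarz)
  also have "\<dots> \<le> c * c" using assms c by (intro mult_mono) auto
  finally have "0 \<le> c\<^sup>2 - u1 \<bullet> u2" by (simp add: power2_eq_square)
  then have "c * norm u1 < c\<^sup>2 - u1 \<bullet> u2 \<longleftrightarrow> (c * norm u1)\<^sup>2 < (c\<^sup>2 - u1 \<bullet> u2)\<^sup>2"
    using c power2_less_imp_less[of "c * norm u1"] power_strict_mono[of "c * norm u1" _ 2]
    by (auto simp del: power_mono_iff)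
  then show ?thesis by (auto simp: power_mult_distrib power2_eq_square algebra_simps)
qed

text \<open>The set is star-shaped about the origin: scaling both velocities by \<open>r\<close>
  multiplies the inner product by \<open>r * r\<close> and the norm by \<open>r\<close>.\<close>

lemma connected_admissible_branch:
  fixes c :: real
  assumes "c > 0"
  shows "connected {(u1 :: real ^ 'n, u2 :: real ^ 'n).
    norm u1 < c \<and> norm u2 < c \<and> u1 \<bullet> u2 < c * (c - norm u1)}" (is "connected ?S")
proof (rule starlike_imp_connected)
  show "starlike ?S"
    unfolding starlike_def
  proof (intro bexI[of _ "(0, 0)"] ballI subsetI)
    show "(0, 0) \<in> ?S" using assms by simp
    fix z y assume z: "z \<in> ?S" and y: "y \<in> closed_segment (0, 0) z"
    obtain u1 u2 where z_eq: "z = (u1, u2)" by (cases z)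
    have u: "norm u1 < c" "norm u2 < c" "u1 \<bullet> u2 < c * (c - norm u1)"
      using z by (simp_all add: z_eq)
    from y obtain r where r: "0 \<le> r" "r \<le> 1" and y_eq: "y = (r *\<^sub>R u1, r *\<^sub>R u2)"
      by (auto simp: z_eq in_segment zero_prod_def[symmetric])
    have n: "norm (r *\<^sub>R w) \<le> norm w" for w :: "real ^ 'n"
      using r by (simp add: mult_left_le_one_le)
    have "r * r * (u1 \<bullet> u2) + r * (c * norm u1) < c * c"
    \<comment> \<open>A nonnegative inner product shrinks under scaling. A negative one may grow,
      but it stays nonpositive, and \<open>norm u1 < c\<close> then suffices.\<close>
    proof (cases "u1 \<bullet> u2 \<ge> 0")
      case True
      have "r * r * (u1 \<bullet> u2) \<le> u1 \<bullet> u2"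
        using True r by (intro mult_left_le_one_le) (auto simp: mult_le_one)
      moreover have "r * (c * norm u1) \<le> c * norm u1"
        using assms r by (intro mult_left_le_one_le) auto
      ultimately show ?thesis using u(3) by (simp add: algebra_simps)
    next
      case False
      then have "r * r * (u1 \<bullet> u2) \<le> 0" using r by (simp add: mult_nonneg_nonpos)
      moreover have "r * (c * norm u1) \<le> c * norm u1"
        using assms r by (intro mult_left_le_one_le) auto
      moreover have "c * norm u1 < c * c" using u assms by simp
      ultimately show ?thesis by linarith
    qed
    then show "y \<in> ?S"
      using n[of u1] n[of u2] u r by (auto simp: y_eq algebra_simps)
  qed
qed


section \<open>Collinear steps along a coordinate axis\<close>

lemma contraction_axis:
  assumes "\<bar>u\<bar> < c"
  shows "contraction c (u *\<^sub>R axis i 1) (axis i 1)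
    = (1 / lorentz_factor c (u *\<^sub>R axis i 1 :: real ^ 'n)) *\<^sub>R (axis i 1 :: real ^ 'n)"
proof -
  let ?u = "u *\<^sub>R axis i 1 :: real ^ 'n"
  define f where "f = boost_coeff c ?u - lorentz_factor c ?u / c\<^sup>2"
  have "1 + f * (?u \<bullet> ?u) = 1 / lorentz_factor c ?u"
    unfolding f_def using assms by (intro contraction_factor) simp
  then have "1 + f * u * u = 1 / lorentz_factor c ?u"
    by (simp add: inner_axis_axis)
  moreover have "contraction c ?u (axis i 1) = (1 + f * u * u) *\<^sub>R axis i 1"
    by (simp add: contraction_def inner_axis_axis scaleR_add_left flip: f_def)
  ultimately show ?thesis by simp
qed

lemma contraction_axis_other:
  "i \<noteq> j \<Longrightarrow> contraction c (u *\<^sub>R axis i 1) (axis j 1 :: real ^ 'n) = axis j 1"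
  by (simp add: contraction_def inner_axis_axis)

lemma axis_form: "axis i 1 \<bullet> (A *v axis i 1) = (A :: real ^ 'n ^ 'n) $ i $ i"
  by (simp add: inner_axis' matrix_vector_mult_basis column_def)

text \<open>Diagonal entries are values of the form at basis vectors. Axis \<open>i\<close> is
  shortened by the Lorentz factor, while axis \<open>j\<close> is orthogonal to both velocities and
  stays fixed. Division by \<open>q00\<close> puts \<open>D\<close> into both denominators.\<close>

lemma subsonicity_collinear:
  fixes i j :: "'n::finite"
  assumes "\<bar>u1\<bar> < c" "\<bar>u2\<bar> < c" "i \<noteq> j"
  defines "W \<equiv> two_step c (u1 *\<^sub>R axis i 1 :: real ^ 'n) (u2 *\<^sub>R axis i 1)"
    and "D \<equiv> (c\<^sup>2 - u1 * u2)\<^sup>2 - c\<^sup>2 * u1\<^sup>2"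
  shows "q00 c W = D / (c\<^sup>2 * (c\<^sup>2 - u1\<^sup>2))"
    and "subsonicity c W $ i $ i = (c\<^sup>2 - u1\<^sup>2)\<^sup>2 * (c\<^sup>2 - u2\<^sup>2) / D"
    and "subsonicity c W $ j $ j = c ^ 4 * (c\<^sup>2 - u1\<^sup>2) / D"
proof -
  let ?u1 = "u1 *\<^sub>R axis i 1 :: real ^ 'n" and ?u2 = "u2 *\<^sub>R axis i 1 :: real ^ 'n"
  define g where "g = lorentz_factor c ?u1"
  have n: "norm ?u1 < c" "norm ?u2 < c" using assms by simp_all
  have c: "c > 0" using assms by linarith
  have lt: "u1\<^sup>2 < c\<^sup>2" using power_strict_mono[OF assms(1), of 2] by simp
  show q: "q00 c W = D / (c\<^sup>2 * (c\<^sup>2 - u1\<^sup>2))"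
    unfolding W_def D_def q00_two_step[OF n] by (simp add: inner_axis_axis mult.commute)
  have "g\<^sup>2 * (1 - u1\<^sup>2 / c\<^sup>2) = 1"
    using lorentz_factor_squared[OF n(1)] by (simp add: g_def inner_axis_axis power2_eq_square)
  then have "1 / g\<^sup>2 = 1 - u1\<^sup>2 / c\<^sup>2"
    by (metis mult_zero_left nonzero_mult_div_cancel_left zero_neq_one)
  then have g: "1 / g\<^sup>2 = (c\<^sup>2 - u1\<^sup>2) / c\<^sup>2"
    using c by (simp add: diff_divide_distrib)
  have "subsonicity c W $ i $ i = (c\<^sup>2 * (1 / g)\<^sup>2 - (u2 * (1 / g))\<^sup>2) / q00 c W"
    unfolding axis_form[symmetric] W_def subsonicity_two_step[OF n] contraction_axis[OF assms(1)]
    by (simp add: inner_axis_axis power_divide flip: g_def)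
  also have "\<dots> = (c\<^sup>2 - u2\<^sup>2) * (1 / g\<^sup>2) / q00 c W"
    by (simp add: power_mult_distrib power_divide algebra_simps diff_divide_distrib)
  also have "\<dots> = (c\<^sup>2 - u1\<^sup>2)\<^sup>2 * (c\<^sup>2 - u2\<^sup>2) / D"
    unfolding q g using c lt by (simp add: power2_eq_square)
  finally show "subsonicity c W $ i $ i = (c\<^sup>2 - u1\<^sup>2)\<^sup>2 * (c\<^sup>2 - u2\<^sup>2) / D" .
  have "subsonicity c W $ j $ j = c\<^sup>2 / q00 c W"
    unfolding axis_form[symmetric] W_def subsonicity_two_step[OF n]
      contraction_axis_other[OF assms(3)]
    using assms(3) by (simp add: inner_axis_axis)
  then show "subsonicity c W $ j $ j = c ^ 4 * (c\<^sup>2 - u1\<^sup>2) / D"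
    unfolding q by (simp add: power2_eq_square power4_eq_xxxx)
qed

section \<open>Limits at the boundary\<close>

lemma tendsto_q00_two_step:
  fixes b1 b2 :: "real ^ 'n"
  assumes "norm b1 < c" "norm b2 < c"
  shows "((\<lambda>(u1, u2). q00 c (two_step c u1 u2)) \<longlongrightarrow> q00 c (two_step c b1 b2)) (at (b1, b2))"
proof -
  let ?f = "\<lambda>x. ((c\<^sup>2 - fst x \<bullet> snd x)\<^sup>2 - c\<^sup>2 * (norm (fst x))\<^sup>2) / (c\<^sup>2 * (c\<^sup>2 - (norm (fst x))\<^sup>2))"
  have c: "c > 0" using assms norm_ge_zero le_less_trans by blast
  have lt: "(norm b1)\<^sup>2 < c\<^sup>2" using assms by (simp add: power_strict_mono)
  have "(?f \<longlongrightarrow> ?f (b1, b2)) (at (b1, b2))"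
    using c lt by (intro tendsto_intros) auto
  \<comment> \<open>The closed formula for \<open>q00\<close> is available only for speeds below
    \<open>c\<close>; these pairs form an open set, so it holds near
    \<open>(b1, b2)\<close>.\<close>
  moreover have "open {x :: (real ^ 'n) \<times> (real ^ 'n). norm (fst x) < c \<and> norm (snd x) < c}"
    by (intro open_Collect_conj open_Collect_less continuous_intros)
  then have "\<forall>\<^sub>F x in at (b1, b2). x \<in> {x. norm (fst x) < c \<and> norm (snd x) < c}"
    using assms by (intro eventually_at_in_open') auto
  then have "\<forall>\<^sub>F x in at (b1, b2). ?f x = (case x of (u1, u2) \<Rightarrow> q00 c (two_step c u1 u2))"
    by eventually_elim (auto simp: q00_two_step)
  ultimately show ?thesis
    by (simp add: q00_two_step[OF assms] Lim_transform_eventually)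
qed

lemma filterlim_rho_at_top:
  assumes "((\<lambda>x. q00 c (W x)) \<longlongrightarrow> 0) F" and "\<forall>\<^sub>F x in F. 0 < q00 c (W x)"
  shows "filterlim (\<lambda>x. rho c (W x)) at_top F"
proof -
  have "((\<lambda>x. sqrt (q00 c (W x))) \<longlongrightarrow> 0) F"
    using tendsto_real_sqrt[OF assms(1)] by simp
  moreover have "\<forall>\<^sub>F x in F. 0 < sqrt (q00 c (W x))"
    using assms(2) by eventually_elim simp
  ultimately have "filterlim (\<lambda>x. inverse (sqrt (q00 c (W x)))) at_top F"
    by (rule filterlim_inverse_at_top)
  moreover have "\<forall>\<^sub>F x in F. inverse (sqrt (q00 c (W x))) = rho c (W x)"
    using assms(2) by eventually_elim (simp add: rho_def powr_minus powr_half_sqrt)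
  ultimately show ?thesis
    using filterlim_cong by fast
qed

lemma filterlim_divide_at_top:
  fixes f g :: "'a \<Rightarrow> real"
  assumes "(f \<longlongrightarrow> l) F" "0 < l" "(g \<longlongrightarrow> 0) F" "\<forall>\<^sub>F x in F. 0 < g x"
  shows "filterlim (\<lambda>x. f x / g x) at_top F"
  unfolding divide_inverse
  by (rule filterlim_tendsto_pos_mult_at_top[OF assms(1,2)])
    (rule filterlim_inverse_at_top[OF assms(3,4)])

text \<open>Makes the simultaneous degeneration precise: the numerators tend to positive limits
  while \<open>D\<close> tends to 0 from above, so both entries blow up.\<close>

lemma filterlim_subsonicity_collinear:
  fixes i j :: "'n::finite"
  assumes "i \<noteq> j" "0 < b1" "b1 < c" "0 < b2" "b2 < c" "(c\<^sup>2 - b1 * b2)\<^sup>2 - c\<^sup>2 * b1\<^sup>2 = 0"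
  defines "F \<equiv> at (b1, b2) within {(u1, u2). 0 < u1 \<and> u1 < c \<and> 0 < u2 \<and> u2 < c \<and>
                 (c\<^sup>2 - u1 * u2)\<^sup>2 - c\<^sup>2 * u1\<^sup>2 > 0}"
    and "A \<equiv> \<lambda>(u1, u2). subsonicity c (two_step c (u1 *\<^sub>R axis i 1 :: real ^ 'n) (u2 *\<^sub>R axis i 1))"
  shows "filterlim (\<lambda>u. A u $ i $ i) at_top F" and "filterlim (\<lambda>u. A u $ j $ j) at_top F"
proof -
  define D where "D = (\<lambda>u. (c\<^sup>2 - fst u * snd u)\<^sup>2 - c\<^sup>2 * (fst u)\<^sup>2)"
  have c: "c > 0" using assms by simp
  have lt: "b1\<^sup>2 < c\<^sup>2" "b2\<^sup>2 < c\<^sup>2" using assms by (simp_all add: power_strict_mono)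
  have ev: "\<forall>\<^sub>F u in F. 0 < fst u \<and> fst u < c \<and> 0 < snd u \<and> snd u < c \<and> 0 < D u"
    unfolding F_def eventually_at_filter D_def by (rule always_eventually) auto
  have "(D \<longlongrightarrow> D (b1, b2)) F"
    unfolding D_def F_def by (intro tendsto_intros) 
  then have D0: "(D \<longlongrightarrow> 0) F" using assms(6) by (simp add: D_def)
  have Dpos: "\<forall>\<^sub>F u in F. 0 < D u" using ev by eventually_elim simp
  have "((\<lambda>u. (c\<^sup>2 - (fst u)\<^sup>2)\<^sup>2 * (c\<^sup>2 - (snd u)\<^sup>2)) \<longlongrightarrow>
      (c\<^sup>2 - (fst (b1, b2))\<^sup>2)\<^sup>2 * (c\<^sup>2 - (snd (b1, b2))\<^sup>2)) F"
    unfolding F_def by (intro tendsto_intros)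
  then have "filterlim (\<lambda>u. (c\<^sup>2 - (fst u)\<^sup>2)\<^sup>2 * (c\<^sup>2 - (snd u)\<^sup>2) / D u) at_top F"
    by (rule filterlim_divide_at_top[OF _ _ D0 Dpos]) (use lt in simp)
  moreover have "\<forall>\<^sub>F u in F. (c\<^sup>2 - (fst u)\<^sup>2)\<^sup>2 * (c\<^sup>2 - (snd u)\<^sup>2) / D u = A u $ i $ i"
    using ev by eventually_elim
      (auto simp: A_def D_def subsonicity_collinear[OF _ _ assms(1)] split: prod.split)
  ultimately show "filterlim (\<lambda>u. A u $ i $ i) at_top F"
    using filterlim_cong by fast
  have "((\<lambda>u. c ^ 4 * (c\<^sup>2 - (fst u)\<^sup>2)) \<longlongrightarrow> c ^ 4 * (c\<^sup>2 - (fst (b1, b2))\<^sup>2)) F"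
    unfolding F_def by (intro tendsto_intros)
  then have "filterlim (\<lambda>u. c ^ 4 * (c\<^sup>2 - (fst u)\<^sup>2) / D u) at_top F"
    by (rule filterlim_divide_at_top[OF _ _ D0 Dpos]) (use lt c in simp)
  moreover have "\<forall>\<^sub>F u in F. c ^ 4 * (c\<^sup>2 - (fst u)\<^sup>2) / D u = A u $ j $ j"
    using ev by eventually_elim
      (auto simp: A_def D_def subsonicity_collinear[OF _ _ assms(1)] split: prod.split)
  ultimately show "filterlim (\<lambda>u. A u $ j $ j) at_top F"
    using filterlim_cong by fast
qed

section \<open>The collinear boundary curve and the golden ratio\<close>

lemma collinear_boundary_iff:
  fixes c :: real
  assumes "0 < u1" "u1 < c" "0 < u2" "u2 < c"
  shows "(c\<^sup>2 - u1 * u2)\<^sup>2 - c\<^sup>2 * u1\<^sup>2 = 0 \<longleftrightarrow> (u1 / c) * (u2 / c) + u1 / c = 1"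
proof -
  have c: "c > 0" using assms by simp
  \<comment> \<open>Both \<open>c\<^sup>2 - u1 * u2\<close> and \<open>c * u1\<close> are
    nonnegative, so equality of squares is equality; dividing by \<open>c\<^sup>2\<close> gives the
    relation between Mach numbers.\<close>
  have "u1 * u2 < c * c" using assms by (intro mult_strict_mono) auto
  then have "(c\<^sup>2 - u1 * u2)\<^sup>2 = (c * u1)\<^sup>2 \<longleftrightarrow> c\<^sup>2 - u1 * u2 = c * u1"
    using assms c by (intro power2_eq_iff_nonneg) (auto simp: power2_eq_square)
  then show ?thesis
    using c by (auto simp: power_mult_distrib power2_eq_square field_simps)
qed

lemma golden_root_iff: "M > 0 \<and> M\<^sup>2 + M = 1 \<longleftrightarrow> M = (sqrt 5 - 1) / 2" for M :: real
proof
  assume M: "M > 0 \<and> M\<^sup>2 + M = 1"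
  then have "(2 * M + 1)\<^sup>2 = 5" by (simp add: power2_eq_square algebra_simps)
  then have "sqrt 5 = 2 * M + 1" using M by (intro real_sqrt_unique) auto
  then show "M = (sqrt 5 - 1) / 2" by simp
next
  assume M: "M = (sqrt 5 - 1) / 2"
  have "sqrt 5 > 1" by simp
  then have "M > 0" by (simp add: M)
  moreover have "M\<^sup>2 + M = 1"
    unfolding M by (simp add: power2_eq_square field_simps)
  ultimately show "M > 0 \<and> M\<^sup>2 + M = 1" ..
qed

section \<open>Collecting the admissibility, limit and boundary statements\<close>

theorem theorem25:
  fixes c :: real
  assumes "c > 0"
    and "CARD('n::finite) = 2 \<or> CARD('n) = 3"
  shows
    "(\<forall>u1 u2 :: real ^ 'n. norm u1 < c \<and> norm u2 < c \<longrightarrow>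
        (admissible c (two_step c u1 u2) \<longleftrightarrow> (c\<^sup>2 - u1 \<bullet> u2)\<^sup>2 > c\<^sup>2 * (norm u1)\<^sup>2) \<and>
        ((c\<^sup>2 - u1 \<bullet> u2)\<^sup>2 > c\<^sup>2 * (norm u1)\<^sup>2 \<longleftrightarrow> u1 \<bullet> u2 < c * (c - norm u1)))
   \<and> connected_component_set
       {(u1 :: real ^ 'n, u2 :: real ^ 'n). norm u1 < c \<and> norm u2 < c \<and>
          (c\<^sup>2 - u1 \<bullet> u2)\<^sup>2 > c\<^sup>2 * (norm u1)\<^sup>2} (0, 0)
     = {(u1, u2). norm u1 < c \<and> norm u2 < c \<and> u1 \<bullet> u2 < c * (c - norm u1)}
   \<and> (\<forall>b1 b2 :: real ^ 'n.
        norm b1 < c \<and> norm b2 < c \<and> (c\<^sup>2 - b1 \<bullet> b2)\<^sup>2 = c\<^sup>2 * (norm b1)\<^sup>2 \<longrightarrow>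
        ((\<lambda>(u1, u2). q00 c (two_step c u1 u2)) \<longlongrightarrow> 0) (at (b1, b2)) \<and>
        filterlim (\<lambda>(u1, u2). rho c (two_step c u1 u2)) at_top
          (at (b1, b2) within
            {(u1, u2). norm u1 < c \<and> norm u2 < c \<and> admissible c (two_step c u1 u2)}))
   \<and> (\<forall>(i::'n) (j::'n) u1 u2 W D. i \<noteq> j \<and> 0 < u1 \<and> u1 < c \<and> 0 < u2 \<and> u2 < c \<and>
        W = two_step c (u1 *\<^sub>R axis i 1) (u2 *\<^sub>R axis i 1) \<and>
        D = (c\<^sup>2 - u1 * u2)\<^sup>2 - c\<^sup>2 * u1\<^sup>2 \<longrightarrow>
        q00 c W = D / (c\<^sup>2 * (c\<^sup>2 - u1\<^sup>2)) \<and>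
        (q00 c W \<noteq> 0 \<longrightarrow>
          subsonicity c W $ i $ i = (c\<^sup>2 - u1\<^sup>2)\<^sup>2 * (c\<^sup>2 - u2\<^sup>2) / D \<and>
          subsonicity c W $ j $ j = c ^ 4 * (c\<^sup>2 - u1\<^sup>2) / D) \<and>
        c\<^sup>2 * (c\<^sup>2 - u1\<^sup>2) > 0 \<and>
        (c\<^sup>2 - u1\<^sup>2)\<^sup>2 * (c\<^sup>2 - u2\<^sup>2) > 0 \<and>
        c ^ 4 * (c\<^sup>2 - u1\<^sup>2) > 0 \<and>
        (q00 c W = 0 \<longleftrightarrow> D = 0) \<and>
        (D = 0 \<longleftrightarrow> (u1 / c) * (u2 / c) + u1 / c = 1))
   \<and> (\<forall>(i::'n) (j::'n) b1 b2. i \<noteq> j \<and> 0 < b1 \<and> b1 < c \<and> 0 < b2 \<and> b2 < c \<and>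
        (c\<^sup>2 - b1 * b2)\<^sup>2 - c\<^sup>2 * b1\<^sup>2 = 0 \<longrightarrow>
        (let F = at (b1, b2) within
                   {(u1, u2). 0 < u1 \<and> u1 < c \<and> 0 < u2 \<and> u2 < c \<and>
                      (c\<^sup>2 - u1 * u2)\<^sup>2 - c\<^sup>2 * u1\<^sup>2 > 0};
             A = (\<lambda>(u1, u2). subsonicity c (two_step c (u1 *\<^sub>R axis i 1) (u2 *\<^sub>R axis i 1)))
         in filterlim (\<lambda>u. A u $ i $ i) at_top F \<and> filterlim (\<lambda>u. A u $ j $ j) at_top F))
   \<and> (\<forall>u. 0 < u \<and> u < c \<longrightarrow>
        ((c\<^sup>2 - u * u)\<^sup>2 - c\<^sup>2 * u\<^sup>2 = 0 \<longleftrightarrow> u / c = (sqrt 5 - 1) / 2))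
   \<and> (\<forall>M::real. M > 0 \<and> M\<^sup>2 + M = 1 \<longleftrightarrow> M = (sqrt 5 - 1) / 2)
   \<and> (\<forall>u1 u2 :: real ^ 'n. norm u1 < c \<and> norm u2 < c \<and> u1 \<bullet> u2 = 0 \<longrightarrow>
        (c\<^sup>2 - u1 \<bullet> u2)\<^sup>2 \<noteq> c\<^sup>2 * (norm u1)\<^sup>2 \<and> admissible c (two_step c u1 u2))"
proof (intro conjI allI impI)
  fix u1 u2 :: "real ^ 'n" assume "norm u1 < c \<and> norm u2 < c"
  then show "admissible c (two_step c u1 u2) \<longleftrightarrow> (c\<^sup>2 - u1 \<bullet> u2)\<^sup>2 > c\<^sup>2 * (norm u1)\<^sup>2"
    and "(c\<^sup>2 - u1 \<bullet> u2)\<^sup>2 > c\<^sup>2 * (norm u1)\<^sup>2 \<longleftrightarrow> u1 \<bullet> u2 < c * (c - norm u1)"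
    using admissible_two_step admissibility_condition_iff by blast+
next
  let ?S = "{(u1 :: real ^ 'n, u2 :: real ^ 'n). norm u1 < c \<and> norm u2 < c \<and>
    (c\<^sup>2 - u1 \<bullet> u2)\<^sup>2 > c\<^sup>2 * (norm u1)\<^sup>2}"
  let ?T = "{(u1 :: real ^ 'n, u2). norm u1 < c \<and> norm u2 < c \<and> u1 \<bullet> u2 < c * (c - norm u1)}"
  \<comment> \<open>The whole set where the squared inequality holds is connected and contains the
    origin, so it is its own component.\<close>
  have "?S = ?T" using admissibility_condition_iff by fastforce
  moreover have "(0, 0) \<in> ?T" using assms(1) by simp
  ultimately show "connected_component_set ?S (0, 0) = ?T"
    using connected_admissible_branch[OF assms(1), where 'n = 'n] by (simp only: connected_component_eq_self)
next
  fix b1 b2 :: "real ^ 'n"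
  assume b: "norm b1 < c \<and> norm b2 < c \<and> (c\<^sup>2 - b1 \<bullet> b2)\<^sup>2 = c\<^sup>2 * (norm b1)\<^sup>2"
  then show lim: "((\<lambda>(u1, u2). q00 c (two_step c u1 u2)) \<longlongrightarrow> 0) (at (b1, b2))"
    using tendsto_q00_two_step[of b1 c b2] by (simp add: q00_two_step)
  let ?F = "at (b1, b2) within
    {(u1, u2). norm u1 < c \<and> norm u2 < c \<and> admissible c (two_step c u1 u2)}"
  \<comment> \<open>The limit is restricted to admissible pairs, where \<open>q00\<close> is
    positive and \<open>rho\<close> is its inverse square root.\<close>
  have "((\<lambda>u. q00 c (case u of (u1, u2) \<Rightarrow> two_step c u1 u2)) \<longlongrightarrow> 0) ?F"
    using tendsto_within_subset[OF lim, of "{(u1, u2). norm u1 < c \<and> norm u2 < c \<and> admissible c (two_step c u1 u2)}"]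
    by (simp add: case_prod_unfold)
  moreover have "\<forall>\<^sub>F u in ?F. 0 < q00 c (case u of (u1, u2) \<Rightarrow> two_step c u1 u2)"
    unfolding eventually_at_filter by (rule always_eventually) (auto simp: admissible_def)
  ultimately show "filterlim (\<lambda>(u1, u2). rho c (two_step c u1 u2)) at_top ?F"
    using filterlim_rho_at_top[of c "\<lambda>(u1, u2). two_step c u1 u2" ?F] by (simp add: case_prod_unfold)
next
  fix i j :: 'n and u1 u2 D :: real and W
  assume *: "i \<noteq> j \<and> 0 < u1 \<and> u1 < c \<and> 0 < u2 \<and> u2 < c \<and>
    W = two_step c (u1 *\<^sub>R axis i 1) (u2 *\<^sub>R axis i 1) \<and>
    D = (c\<^sup>2 - u1 * u2)\<^sup>2 - c\<^sup>2 * u1\<^sup>2"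
  have lt: "u1\<^sup>2 < c\<^sup>2" "u2\<^sup>2 < c\<^sup>2" using * by (simp_all add: power_strict_mono)
  show q: "q00 c W = D / (c\<^sup>2 * (c\<^sup>2 - u1\<^sup>2))"
    and "subsonicity c W $ i $ i = (c\<^sup>2 - u1\<^sup>2)\<^sup>2 * (c\<^sup>2 - u2\<^sup>2) / D"
    and "subsonicity c W $ j $ j = c ^ 4 * (c\<^sup>2 - u1\<^sup>2) / D"
    using * subsonicity_collinear[of u1 c u2 i j] by simp_all
  show "c\<^sup>2 * (c\<^sup>2 - u1\<^sup>2) > 0" "(c\<^sup>2 - u1\<^sup>2)\<^sup>2 * (c\<^sup>2 - u2\<^sup>2) > 0" "c ^ 4 * (c\<^sup>2 - u1\<^sup>2) > 0"
    using assms(1) lt by simp_all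
  then show "q00 c W = 0 \<longleftrightarrow> D = 0" unfolding q using lt assms(1) by simp
  show "D = 0 \<longleftrightarrow> (u1 / c) * (u2 / c) + u1 / c = 1"
    using * collinear_boundary_iff[of u1 c u2] by simp
next
  fix i j :: 'n and b1 b2 :: real
  assume "i \<noteq> j \<and> 0 < b1 \<and> b1 < c \<and> 0 < b2 \<and> b2 < c \<and> (c\<^sup>2 - b1 * b2)\<^sup>2 - c\<^sup>2 * b1\<^sup>2 = 0"
  then show "let F = at (b1, b2) within
                   {(u1, u2). 0 < u1 \<and> u1 < c \<and> 0 < u2 \<and> u2 < c \<and>
                      (c\<^sup>2 - u1 * u2)\<^sup>2 - c\<^sup>2 * u1\<^sup>2 > 0};
             A = (\<lambda>(u1, u2). subsonicity c (two_step c (u1 *\<^sub>R axis i 1) (u2 *\<^sub>R axis i 1)))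
         in filterlim (\<lambda>u. A u $ i $ i) at_top F \<and> filterlim (\<lambda>u. A u $ j $ j) at_top F"
    unfolding Let_def using filterlim_subsonicity_collinear[of i j b1 c b2] by blast
next
  fix u assume u: "0 < u \<and> u < c"
  \<comment> \<open>Equal steps turn the boundary relation into \<open>M\<^sup>2 + M = 1\<close> for
    \<open>M = u / c\<close>; positivity of \<open>u / c\<close> is carried along to select the
    root.\<close>
  have "(c\<^sup>2 - u * u)\<^sup>2 - c\<^sup>2 * u\<^sup>2 = 0 \<longleftrightarrow> u / c > 0 \<and> (u / c)\<^sup>2 + u / c = 1"
    using u collinear_boundary_iff[of u c u] by (simp add: power2_eq_square)
  then show "(c\<^sup>2 - u * u)\<^sup>2 - c\<^sup>2 * u\<^sup>2 = 0 \<longleftrightarrow> u / c = (sqrt 5 - 1) / 2"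
    by (simp only: golden_root_iff)
next
  show "M > 0 \<and> M\<^sup>2 + M = 1 \<longleftrightarrow> M = (sqrt 5 - 1) / 2" for M :: real
    by (rule golden_root_iff)
next
  fix u1 u2 :: "real ^ 'n" assume u: "norm u1 < c \<and> norm u2 < c \<and> u1 \<bullet> u2 = 0"
  \<comment> \<open>With zero inner product, the linear form of the condition is just
    \<open>norm u1 < c\<close>.\<close>
  then have "(c\<^sup>2 - u1 \<bullet> u2)\<^sup>2 > c\<^sup>2 * (norm u1)\<^sup>2"
    using admissibility_condition_iff[of u1 c u2] assms(1) by simp
  then show "(c\<^sup>2 - u1 \<bullet> u2)\<^sup>2 \<noteq> c\<^sup>2 * (norm u1)\<^sup>2" "admissible c (two_step c u1 u2)"
    using u admissible_two_step[of u1 c u2] by auto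
qed

end
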